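(* Let $f=h+\overline{g}\in\mathcal{UK}^0_H$ with $h(z)=z+\sum_{n\ge2}a_nz^n$. Then $|a_2|\le1/\sqrt{3}$. Moreover, every $f\in\mathcal{UK}^0_H$ satisfies $$\left(\frac{\sqrt{3}}{\sqrt{3}+4}\right)\left[1-\left(\frac{1-r}{1+r}\right)^{\frac{\sqrt{3}+4}{2\sqrt{3}}}\right]\le|f(z)|\le\left(\frac{\sqrt{3}}{\sqrt{3}+4}\right)\left[\left(\frac{1+r}{1-r}\right)^{\frac{\sqrt{3}+4}{2\sqrt{3}}}-1\right]$$ for $0<|z|=r<1$.
   Context: $\mathbb{D}=\{z\in\mathbb{C}:|z|<1\}$. $\mathcal{H}$ is the class of complex-valued harmonic functions $f=h+\overline{g}$ in $\mathbb{D}$, with $h,g$ analytic in $\mathbb{D}$ and $h(z)=z+\sum_{n\ge2}a_nz^n$, $g(z)=\sum_{n\ge1}b_nz^n$. $\mathcal{S}_H$ is the class of $f\in\mathcal{H}$ that are univalent and sense-preserving ($J_f=|h'|^2-|g'|^2>0$) in $\mathbb{D}$, and $\mathcal{S}^0_H=\{f\in\mathcal{S}_H:b_1=g'(0)=0\}$. A locally univalent $f\in\mathcal{H}$ is fully convex if $f(\{|z|<r\})$ is a convex domain for each $r\in(0,1)$. It is uniformly convex in $\mathbb{D}$ if it is fully convex in $\mathbb{D}$ and maps every circular arc $\gamma$ contained in $\mathbb{D}$ with center in $\mathbb{D}$ onto a convex arc $f(\gamma)$ (the tangent direction turns monotonically, in the positive sense, as $\gamma$ is traversed positively). It is known that uniform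 convexity is equivalent to $\operatorname{Re}P(z,\zeta)\ge0$ for all $z\ne\zeta$ in $\mathbb{D}$, where $$P(z,\zeta)=\frac{(z-\zeta)h'(z)+(z-\zeta)^2h''(z)+\overline{(z-\zeta)g'(z)}+\overline{(z-\zeta)^2g''(z)}}{(z-\zeta)h'(z)-\overline{(z-\zeta)g'(z)}}.$$ $\mathcal{UK}^0_H$ is the class of all $f\in\mathcal{S}^0_H$ that are uniformly convex in $\mathbb{D}$. *)

theory Defs
  imports "HOL-Complex_Analysis.Complex_Analysis"
begin

abbreviation unit_disc :: "complex set" where
  "unit_disc \<equiv> ball 0 1"

text \<open>A function on the unit disc is a total function \<open>complex \<Rightarrow> complex\<close>; its values outside
  the disc are irrelevant. For analytic \<open>h\<close>, \<open>g\<close> the conditions at \<open>0\<close> say exactly that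
  \<open>h(z) = z + (\<Sum>n\<ge>2. a n * z^n)\<close> and \<open>g(z) = (\<Sum>n\<ge>1. b n * z^n)\<close>. The pair \<open>(h, g)\<close> is
  determined on the disc by \<open>f\<close>.\<close>
definition harmonic_rep :: "(complex \<Rightarrow> complex) \<Rightarrow> (complex \<Rightarrow> complex) \<Rightarrow> (complex \<Rightarrow> complex) \<Rightarrow> bool"
  where
  "harmonic_rep f h g \<longleftrightarrow>
     h holomorphic_on unit_disc \<and> g holomorphic_on unit_disc \<and>
     h 0 = 0 \<and> deriv h 0 = 1 \<and> g 0 = 0 \<and>
     (\<forall>z\<in>unit_disc. f z = h z + cnj (g z))"

definition class_H :: "(complex \<Rightarrow> complex) set" where
  "class_H = {f. \<exists>h g. harmonic_rep f h g}"

definition class_SH :: "(complex \<Rightarrow> complex) set" where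
  "class_SH = {f. \<exists>h g. harmonic_rep f h g \<and> inj_on f unit_disc \<and>
     (\<forall>z\<in>unit_disc. (cmod (deriv h z))\<^sup>2 - (cmod (deriv g z))\<^sup>2 > 0)}"

definition class_SH0 :: "(complex \<Rightarrow> complex) set" where
  "class_SH0 = {f \<in> class_SH. \<exists>h g. harmonic_rep f h g \<and> deriv g 0 = 0}"

definition locally_univalent :: "(complex \<Rightarrow> complex) \<Rightarrow> bool" where
  "locally_univalent f \<longleftrightarrow> (\<forall>z\<in>unit_disc. \<exists>e>0. ball z e \<subseteq> unit_disc \<and> inj_on f (ball z e))"

definition fully_convex :: "(complex \<Rightarrow> complex) \<Rightarrow> bool" where
  "fully_convex f \<longleftrightarrow> f \<in> class_H \<and> locally_univalent f \<and>
     (\<forall>r. 0 < r \<and> r < 1 \<longrightarrow> open (f ` ball 0 r) \<and> convex (f ` ball 0 r))"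

text \<open>The curve \<open>c\<close> has a nonzero tangent vector at each parameter in \<open>{a..b}\<close>, and a continuous
  branch \<open>\<theta>\<close> of its argument is nondecreasing. Continuity of \<open>\<theta>\<close> is essential: without it, jumps
  by multiples of \<open>2 * pi\<close> could hide a tangent turning in the negative sense.\<close>
definition convex_arc_on :: "real \<Rightarrow> real \<Rightarrow> (real \<Rightarrow> complex) \<Rightarrow> bool" where
  "convex_arc_on a b c \<longleftrightarrow>
     (\<exists>\<theta>. continuous_on {a..b} \<theta> \<and> mono_on {a..b} \<theta> \<and>
        (\<forall>t\<in>{a..b}. \<exists>s>0.
           (c has_vector_derivative (complex_of_real s * cis (\<theta> t))) (at t within {a..b})))"

text \<open>The image of a circular arc is taken with the parametrization that traverses the arc
  counterclockwise; full circles are allowed.\<close>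
definition uniformly_convex :: "(complex \<Rightarrow> complex) \<Rightarrow> bool" where
  "uniformly_convex f \<longleftrightarrow> fully_convex f \<and>
     (\<forall>\<zeta> \<rho> a b. \<zeta> \<in> unit_disc \<and> 0 < \<rho> \<and> a < b \<and> b \<le> a + 2 * pi \<and>
        (\<forall>t\<in>{a..b}. \<zeta> + complex_of_real \<rho> * cis t \<in> unit_disc) \<longrightarrow>
        convex_arc_on a b (\<lambda>t. f (\<zeta> + complex_of_real \<rho> * cis t)))"

definition class_UKH0 :: "(complex \<Rightarrow> complex) set" where
  "class_UKH0 = {f \<in> class_SH0. uniformly_convex f}"

end

theory Submission
  imports Defs
begin

text \<open>
  Write \<open>A = h'\<close>, \<open>B = g'\<close> and \<open>J = \<bar>A\<bar>\<^sup>2 - \<bar>B\<bar>\<^sup>2\<close>, so that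
  \<open>\<partial>J/\<partial>z = A' * cnj A - B' * cnj B\<close>. Uniform convexity says that the image of a small
  circular arc through \<open>z\<close> about a centre \<open>z - u\<close> in the disc does not turn to the right at
  \<open>z\<close>. Expanding this curvature condition and dividing by \<open>\<bar>u\<bar>\<^sup>2\<close> turns it into
  \<open>J + Re (u * \<partial>J/\<partial>z) + Re (u^3 * (B' * A - A' * B)) / \<bar>u\<bar>\<^sup>2 \<ge> 0\<close>.

  The cubic term is the only one that is not governed by \<open>J\<close>, and it disappears on averaging
  over two centres: for \<open>u = \<rho> * v * cis (\<plusminus>pi/6)\<close> the two values of \<open>u^3\<close> are opposite, while
  the mean of the two \<open>u\<close> is \<open>(\<surd>3/2) * \<rho> * v\<close>. Hence
  \<open>J + (\<surd>3/2) * \<rho> * Re (v * \<partial>J/\<partial>z) \<ge> 0\<close> as soon as both centres lie in the disc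
  (\<open>harmonic_jacobian_dz_bound\<close>). This is where \<open>\<surd>3\<close> comes from.

  At \<open>z = 0\<close> we have \<open>J = 1\<close> and \<open>\<partial>J/\<partial>z = h''(0)\<close>, and every \<open>\<rho> < 1\<close> is allowed, so the
  inequality is the coefficient bound (\<open>second_coefficient_bound\<close>).

  Along a radius, with \<open>j(t) = J(t * e)\<close>, the inward choice allows \<open>\<rho> = 1\<close> and the outward one
  every \<open>\<rho> < 1 - t\<close>; so \<open>-4/\<surd>3 \<le> j'/j \<le> (4/\<surd>3)/(1 - t)\<close>. Integration bounds \<open>J\<close> on both
  sides (\<open>harmonic_jacobian_bounds\<close>). The Schwarz lemma for the dilatation \<open>B/A\<close>, which vanishes
  at \<open>0\<close>, converts this into bounds for the largest and smallest stretching \<open>\<bar>A\<bar> \<plusminus> \<bar>B\<bar>\<close> of \<open>f\<close>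
  at \<open>z\<close> (\<open>stretching_bounds\<close>). With \<open>\<gamma> = 1/2 + 2/\<surd>3\<close> the derivatives of the two
  growth functions are weaker bounds of the same kind. The upper estimate for \<open>\<bar>f z\<bar>\<close> follows by integrating along the radius to
  \<open>z\<close>, the lower one by integrating along the preimage of the segment from \<open>0\<close> to \<open>f z\<close>, which
  exists because \<open>f\<close> maps concentric discs onto convex sets.
\<close>

section \<open>The Jacobian of a harmonic map\<close>

definition harmonic_jacobian :: "(complex \<Rightarrow> complex) \<Rightarrow> (complex \<Rightarrow> complex) \<Rightarrow> complex \<Rightarrow> real" where
  "harmonic_jacobian h g z = (cmod (deriv h z))\<^sup>2 - (cmod (deriv g z))\<^sup>2"

text \<open>The Wirtinger derivative \<open>\<partial>J/\<partial>z\<close>; since \<open>J\<close> is real, its derivative in a direction \<open>v\<close>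
  is \<open>2 * Re (v * \<partial>J/\<partial>z)\<close>.\<close>
definition harmonic_jacobian_dz :: "(complex \<Rightarrow> complex) \<Rightarrow> (complex \<Rightarrow> complex) \<Rightarrow> complex \<Rightarrow> complex" where
  "harmonic_jacobian_dz h g z =
     deriv (deriv h) z * cnj (deriv h z) - deriv (deriv g) z * cnj (deriv g z)"

lemma has_real_derivative_cmod_sq:
  assumes "(p has_vector_derivative p') (at t)"
  shows "((\<lambda>t. (cmod (p t))\<^sup>2) has_real_derivative 2 * Re (p' * cnj (p t))) (at t)"
proof -
  have "((\<lambda>t. inner (p t) (p t)) has_derivative
          (\<lambda>s. inner (p t) (s *\<^sub>R p') + inner (s *\<^sub>R p') (p t))) (at t)"
    using assms unfolding has_vector_derivative_def by (intro derivative_intros)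
  then show ?thesis
    unfolding has_field_derivative_def power2_norm_eq_inner
    by (rule has_derivative_eq_rhs) (auto simp: inner_complex_def algebra_simps fun_eq_iff)
qed

lemma has_real_derivative_Im:
  assumes "(p has_vector_derivative p') (at t)"
  shows "((\<lambda>t. Im (p t)) has_real_derivative Im p') (at t)"
proof -
  have "((\<lambda>t. Im (p t)) has_derivative (\<lambda>s. Im (s *\<^sub>R p'))) (at t)"
    using assms unfolding has_vector_derivative_def by (rule has_derivative_Im)
  then show ?thesis
    unfolding has_field_derivative_def
    by (rule has_derivative_eq_rhs) (auto simp: fun_eq_iff)
qed

text \<open>The left side is \<open>Re (N * cnj D)\<close> for the numerator \<open>N\<close> and the denominator \<open>D\<close> of the
  quotient \<open>P(z, z - u)\<close> that characterises uniform convexity. The right side isolates the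
  only part that is not expressed by the Jacobian and its derivative.\<close>
lemma curvature_numerator:
  fixes u A B A' B' :: complex
  shows "Re ((u * A + u\<^sup>2 * A' + cnj (u * B + u\<^sup>2 * B')) * cnj (u * A - cnj (u * B))) =
    (cmod u)\<^sup>2 * ((cmod A)\<^sup>2 - (cmod B)\<^sup>2 + Re (u * (A' * cnj A - B' * cnj B))) +
    Re (u ^ 3 * (B' * A - A' * B))"
  unfolding cmod_power2 by (simp add: power2_eq_square power3_eq_cube algebra_simps)

locale harmonic_map =
  fixes f h g :: "complex \<Rightarrow> complex"
  assumes rep: "harmonic_rep f h g"
begin

lemma holo: "h holomorphic_on ball 0 1" "g holomorphic_on ball 0 1"
  and holo': "deriv h holomorphic_on ball 0 1" "deriv g holomorphic_on ball 0 1"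
  using rep by (auto simp: harmonic_rep_def intro: holomorphic_deriv)

lemma has_field_derivatives:
  assumes "z \<in> ball 0 1"
  shows "(h has_field_derivative deriv h z) (at z)"
    "(g has_field_derivative deriv g z) (at z)"
    "(deriv h has_field_derivative deriv (deriv h) z) (at z)"
    "(deriv g has_field_derivative deriv (deriv g) z) (at z)"
  using assms holo holo' by (auto intro: holomorphic_derivI)

lemma f_zero: "f 0 = 0"
  using rep by (simp add: harmonic_rep_def)

lemma has_derivative_f:
  assumes "z \<in> ball 0 1"
  shows "(f has_derivative (\<lambda>v. deriv h z * v + cnj (deriv g z * v))) (at z)"
proof -
  have "((\<lambda>z. h z + cnj (g z)) has_derivative (\<lambda>v. deriv h z * v + cnj (deriv g z * v))) (at z)"
    using has_field_derivatives[OF assms] unfolding has_field_derivative_def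
    by (intro derivative_intros)
  moreover have "\<And>w. w \<in> ball 0 1 \<Longrightarrow> h w + cnj (g w) = f w"
    using rep by (simp add: harmonic_rep_def)
  ultimately show ?thesis
    by (rule has_derivative_transform_within_open[OF _ open_ball assms])
qed

lemma continuous_on_f: "continuous_on (ball 0 1) f"
  by (meson has_derivative_f continuous_at_imp_continuous_on has_derivative_continuous)

lemma has_vector_derivative_f:
  assumes "(p has_vector_derivative p') (at t)" "p t \<in> ball 0 1"
  shows "((\<lambda>t. f (p t)) has_vector_derivative
           (deriv h (p t) * p' + cnj (deriv g (p t) * p'))) (at t)"
proof -
  have "((\<lambda>t. f (p t)) has_derivative
      (\<lambda>s. deriv h (p t) * (s *\<^sub>R p') + cnj (deriv g (p t) * (s *\<^sub>R p')))) (at t)"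
    using has_derivative_compose[OF assms(1)[unfolded has_vector_derivative_def]
        has_derivative_f[OF assms(2)]] .
  then show ?thesis
    unfolding has_vector_derivative_def
    by (rule has_derivative_eq_rhs) (auto simp: algebra_simps)
qed

lemma has_vector_derivative_derivs:
  assumes "(p has_vector_derivative p') (at t)" "p t \<in> ball 0 1"
  shows "((\<lambda>t. deriv h (p t)) has_vector_derivative (p' * deriv (deriv h) (p t))) (at t)"
    and "((\<lambda>t. deriv g (p t)) has_vector_derivative (p' * deriv (deriv g) (p t))) (at t)"
  using field_vector_diff_chain_at[OF assms(1) has_field_derivatives(3)[OF assms(2)]]
    field_vector_diff_chain_at[OF assms(1) has_field_derivatives(4)[OF assms(2)]]
  by (simp_all add: o_def)

lemma has_real_derivative_harmonic_jacobian:
  assumes "(p has_vector_derivative p') (at t)" "p t \<in> ball 0 1"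
  shows "((\<lambda>t. harmonic_jacobian h g (p t)) has_real_derivative
           2 * Re (p' * harmonic_jacobian_dz h g (p t))) (at t)"
  unfolding harmonic_jacobian_def
  using DERIV_diff[OF has_real_derivative_cmod_sq[OF has_vector_derivative_derivs(1)[OF assms]]
    has_real_derivative_cmod_sq[OF has_vector_derivative_derivs(2)[OF assms]]]
  by (rule DERIV_cong) (simp add: harmonic_jacobian_dz_def algebra_simps)

text \<open>The real derivative of \<open>f\<close> determines its complex linear and its conjugate linear part, so
  statements about \<open>h'\<close> and \<open>g'\<close> transfer between different representations of \<open>f\<close>.\<close>
lemma derivs_unique:
  assumes "harmonic_rep f h1 g1" "z \<in> ball 0 1"
  shows "deriv h1 z = deriv h z" "deriv g1 z = deriv g z"
proof -
  interpret other: harmonic_map f h1 g1 by unfold_locales (rule assms)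
  have eq: "deriv h1 z * v + cnj (deriv g1 z * v) = deriv h z * v + cnj (deriv g z * v)" for v
    using has_derivative_unique[OF other.has_derivative_f[OF assms(2)] has_derivative_f[OF assms(2)]]
    by meson
  show "deriv h1 z = deriv h z" "deriv g1 z = deriv g z"
    using eq[of 1] eq[of \<i>] by (auto simp: complex_eq_iff)
qed

end

section \<open>Curvature of images of circular arcs\<close>

locale uniformly_convex_map = harmonic_map +
  assumes uc: "uniformly_convex f"
    and harmonic_jacobian_pos: "z \<in> ball 0 1 \<Longrightarrow> 0 < harmonic_jacobian h g z"
    and deriv_g_zero: "deriv g 0 = 0"
    and inj_f: "inj_on f (ball 0 1)"
begin

text \<open>A continuous argument that starts at \<open>\<theta>(a)\<close> and does not decrease stays below
  \<open>\<theta>(a) + pi\<close> for a while. Hence \<open>Im (T(t) * cnj (T(a)))\<close>, where \<open>T\<close> is the tangent of the image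
  curve, is nonnegative to the right of its zero \<open>a\<close>, and so is its derivative at \<open>a\<close>, which is
  the quantity in question.\<close>
lemma curvature_nonneg:
  assumes z: "z \<in> ball 0 1" and w: "w \<in> ball 0 1" and "z \<noteq> w"
  defines "u \<equiv> z - w"
  shows "0 \<le> Re ((u * deriv h z + u\<^sup>2 * deriv (deriv h) z
                  + cnj (u * deriv g z + u\<^sup>2 * deriv (deriv g) z))
                 * cnj (u * deriv h z - cnj (u * deriv g z)))"
    (is "0 \<le> ?K")
proof -
  define \<rho> where "\<rho> = cmod u"
  define a where "a = Arg u"
  define p where "p t = w + of_real \<rho> * cis t" for t
  define T where "T t = \<i> * (p t - w) * deriv h (p t) + cnj (\<i> * (p t - w) * deriv g (p t))" for t
  have \<rho>: "\<rho> > 0" using \<open>z \<noteq> w\<close> by (simp add: \<rho>_def u_def)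
  have pa: "p a = z"
    using rcis_cmod_Arg[of u] by (simp add: p_def a_def \<rho>_def u_def rcis_def)
  have p': "(p has_vector_derivative \<i> * (p t - w)) (at t)" for t
  proof -
    have "((\<lambda>t. w + of_real \<rho> * exp (\<i> * of_real t)) has_vector_derivative
           of_real \<rho> * (\<i> * exp (\<i> * of_real t))) (at t)"
      by (auto intro!: derivative_eq_intros has_vector_derivative_real_field)
    then show ?thesis by (simp add: p_def[abs_def] cis_conv_exp mult_ac)
  qed
  have "continuous_on UNIV p"
    using p' by (meson continuous_at_imp_continuous_on has_vector_derivative_continuous)
  then have "open (p -` ball 0 1)"
    by (intro open_vimage open_ball)
  moreover have "a \<in> p -` ball 0 1" using z pa by simp
  ultimately obtain d where d: "d > 0" "\<And>t. dist t a < d \<Longrightarrow> p t \<in> ball 0 1"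
    unfolding open_dist by blast
  \<comment> \<open>an arc short enough to stay inside the disc, which the full circle about \<open>w\<close> need not do\<close>
  define b where "b = a + min (d / 2) pi"
  have ab: "a < b" "b \<le> a + 2 * pi" using d(1) pi_gt_zero by (auto simp: b_def min_def)
  have pD: "p t \<in> ball 0 1" if "t \<in> {a..b}" for t
    using that d by (intro d(2)) (auto simp: b_def dist_real_def)
  have "convex_arc_on a b (\<lambda>t. f (p t))"
    using uc \<rho> ab pD w unfolding uniformly_convex_def p_def by blast
  then obtain \<theta> where \<theta>: "continuous_on {a..b} \<theta>" "mono_on {a..b} \<theta>"
    and \<theta>': "\<And>t. t \<in> {a..b} \<Longrightarrow> \<exists>s>0. ((\<lambda>t. f (p t)) has_vector_derivative
              (complex_of_real s * cis (\<theta> t))) (at t within {a..b})"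
    unfolding convex_arc_on_def by blast
  have T: "\<exists>s>0. T t = of_real s * cis (\<theta> t)" if t: "t \<in> {a..b}" for t
  proof -
    obtain s where s: "s > 0" "((\<lambda>t. f (p t)) has_vector_derivative
              (complex_of_real s * cis (\<theta> t))) (at t within cbox a b)"
      using \<theta>'[OF t] by (auto simp: cbox_interval)
    have "((\<lambda>t. f (p t)) has_vector_derivative T t) (at t within cbox a b)"
      using has_vector_derivative_f[OF p' pD[OF t]]
      by (auto simp: T_def mult_ac intro: has_vector_derivative_at_within)
    from vector_derivative_unique_within_closed_interval[OF ab(1) _ this s(2)] t s(1)
    show ?thesis by (auto simp: cbox_interval)
  qed
  have aI: "a \<in> {a..b}" using ab by simp
  obtain s0 where s0: "s0 > 0" "T a = of_real s0 * cis (\<theta> a)" using T[OF aI] by blast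
  have "\<exists>e>0. \<forall>t\<in>{a..b}. dist t a < e \<longrightarrow> dist (\<theta> t) (\<theta> a) < pi"
    using \<theta>(1) aI pi_gt_zero unfolding continuous_on_iff by blast
  then obtain e where e: "e > 0" "\<And>t. t \<in> {a..b} \<Longrightarrow> dist t a < e \<Longrightarrow> dist (\<theta> t) (\<theta> a) < pi"
    by blast
  define \<phi> where "\<phi> t = Im (T t * cnj (T a))" for t
  have \<phi>_nonneg: "\<phi> t \<ge> 0" if t: "t \<in> {a..b}" "dist t a < e" for t
  proof -
    obtain s where s: "s > 0" "T t = of_real s * cis (\<theta> t)" using T[OF t(1)] by blast
    have "T t * cnj (T a) = of_real (s * s0) * cis (\<theta> t - \<theta> a)"
      by (simp add: s s0 cis_cnj cis_mult)
    then have "\<phi> t = s * s0 * sin (\<theta> t - \<theta> a)" by (simp add: \<phi>_def)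
    moreover have "0 \<le> \<theta> t - \<theta> a" using mono_onD[OF \<theta>(2) aI t(1)] t(1) by simp
    moreover have "\<theta> t - \<theta> a < pi" using e(2)[OF t] by (simp add: dist_real_def)
    ultimately show ?thesis using s s0 by (simp add: sin_ge_zero)
  qed
  have "(T has_vector_derivative
      (\<i> * (p a - w) * (\<i> * (p a - w) * deriv (deriv h) (p a)) + \<i> * (\<i> * (p a - w)) * deriv h (p a)
       + cnj (\<i> * (p a - w) * (\<i> * (p a - w) * deriv (deriv g) (p a))
              + \<i> * (\<i> * (p a - w)) * deriv g (p a)))) (at a)"
    unfolding T_def
    by (intro has_vector_derivative_add has_vector_derivative_mult has_vector_derivative_cnj
        has_vector_derivative_derivs p' has_vector_derivative_mult_right
        has_vector_derivative_diff_const[THEN iffD2] pD aI)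
  then have "(T has_vector_derivative
      - (u * deriv h z + u\<^sup>2 * deriv (deriv h) z
         + cnj (u * deriv g z + u\<^sup>2 * deriv (deriv g) z))) (at a)"
    by (simp add: pa u_def[symmetric] power2_eq_square algebra_simps)
  from has_real_derivative_Im[OF has_vector_derivative_mult_left[OF this, of "cnj (T a)"]]
  have "(\<phi> has_real_derivative ?K) (at a)"
    unfolding \<phi>_def
    by (rule DERIV_cong) (simp add: T_def pa u_def[symmetric] algebra_simps)
  then show ?thesis
  proof (rule contrapos_pp)
    assume *: "\<not> 0 \<le> ?K"
    show "\<not> (\<phi> has_real_derivative ?K) (at a)"
    proof
      assume "(\<phi> has_real_derivative ?K) (at a)"
      then obtain d' where d': "d' > 0" "\<And>k. k > 0 \<Longrightarrow> k < d' \<Longrightarrow> \<phi> (a + k) < \<phi> a"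
        using DERIV_neg_dec_right * by (metis not_le)
      define k where "k = min (d' / 2) (min (e / 2) (b - a))"
      have "k > 0" "k < d'" "k < e" "k \<le> b - a" using d' e ab by (auto simp: k_def)
      then have "\<phi> (a + k) < \<phi> a" "\<phi> (a + k) \<ge> 0"
        using d' by (auto intro!: \<phi>_nonneg simp: dist_real_def)
      then show False by (simp add: \<phi>_def)
    qed
  qed
qed

text \<open>The sum of the curvature inequalities for the centres \<open>z - \<rho> * v * cis (\<plusminus>pi/6)\<close>: as
  \<open>cis (\<plusminus>pi/6)^3 = \<plusminus>\<i>\<close>, their cubic terms cancel.\<close>
lemma harmonic_jacobian_dz_bound:
  assumes z: "z \<in> ball 0 1" and v: "cmod v = 1" and \<rho>: "0 < \<rho>"
    and u: "z - of_real \<rho> * v * cis (pi / 6) \<in> ball 0 1"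
      "z - of_real \<rho> * v * cis (- (pi / 6)) \<in> ball 0 1"
  shows "0 \<le> harmonic_jacobian h g z + \<rho> * (sqrt 3 / 2) * Re (v * harmonic_jacobian_dz h g z)"
proof -
  define q where "q = \<rho>^3 * Re (\<i> * v ^ 3 * (deriv (deriv g) z * deriv h z - deriv (deriv h) z * deriv g z))"
  have Re_of_real_mult: "Re (of_real r * x) = r * Re x" for r x by simp
  have *: "0 \<le> \<rho>\<^sup>2 * (harmonic_jacobian h g z + \<rho> * Re (v * harmonic_jacobian_dz h g z * cis (\<sigma> * (pi / 6)))) + \<sigma> * q"
    if \<sigma>: "\<sigma> = 1 \<or> \<sigma> = - 1" for \<sigma> :: real
  proof -
    define x where "x = of_real \<rho> * v * cis (\<sigma> * (pi / 6))"
    have cx: "cmod x = \<rho>" using v \<rho> by (simp add: x_def norm_mult)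
    have "cis (\<sigma> * (pi / 6)) ^ 3 = cis (\<sigma> * (pi / 2))" by (simp only: Complex.DeMoivre) (simp add: mult.commute)
    also have "\<dots> = of_real \<sigma> * \<i>" using \<sigma> by (auto simp: complex_eq_iff)
    finally have x3: "x ^ 3 = of_real (\<sigma> * \<rho> ^ 3) * (\<i> * v ^ 3)"
      by (simp add: x_def power_mult_distrib mult_ac)
    have "z - x \<in> ball 0 1" using u \<sigma> by (auto simp: x_def)
    moreover have "z - (z - x) = x" by simp
    moreover have "z \<noteq> z - x" using cx \<rho> by auto
    ultimately have "0 \<le> (cmod x)\<^sup>2 * (harmonic_jacobian h g z + Re (x * harmonic_jacobian_dz h g z))
        + Re (x ^ 3 * (deriv (deriv g) z * deriv h z - deriv (deriv h) z * deriv g z))"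
      using curvature_nonneg[OF z, of "z - x"]
      unfolding \<open>z - (z - x) = x\<close> curvature_numerator
        harmonic_jacobian_def harmonic_jacobian_dz_def by blast
    moreover have "Re (x * harmonic_jacobian_dz h g z)
        = \<rho> * Re (v * harmonic_jacobian_dz h g z * cis (\<sigma> * (pi / 6)))"
      unfolding Re_of_real_mult[symmetric] by (simp only: x_def mult_ac)
    moreover have "Re (x ^ 3 * (deriv (deriv g) z * deriv h z - deriv (deriv h) z * deriv g z)) = \<sigma> * q"
      unfolding x3 q_def Re_of_real_mult[symmetric] of_real_mult by (simp only: mult_ac)
    ultimately show ?thesis by (simp add: cx)
  qed
  have "0 \<le> 2 * \<rho>\<^sup>2 * (harmonic_jacobian h g z + \<rho> * (sqrt 3 / 2) * Re (v * harmonic_jacobian_dz h g z))"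
    using *[of 1] *[of "-1"] by (simp add: cos_30 sin_30 algebra_simps)
  then show ?thesis using \<rho> by (simp add: zero_le_mult_iff)
qed

end

section \<open>The comparison function\<close>

definition growth_exponent :: real ("\<gamma>") where
  "\<gamma> = (sqrt 3 + 4) / (2 * sqrt 3)"

text \<open>The upper bound of the growth theorem is \<open>growth r\<close> and the lower bound is
  \<open>- growth (- r)\<close>, so one function on \<open>(-1, 1)\<close> serves both.\<close>
definition growth :: "real \<Rightarrow> real" where
  "growth t = (((1 + t) / (1 - t)) powr \<gamma> - 1) / (2 * \<gamma>)"

text \<open>This is \<open>(1 + t) powr (\<gamma> - 1) / (1 - t) powr (\<gamma> + 1)\<close>; in exponential form, comparison with
  it becomes a linear inequality between logarithms.\<close>
definition growth_deriv :: "real \<Rightarrow> real" where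
  "growth_deriv t = exp ((\<gamma> - 1) * ln (1 + t) - (\<gamma> + 1) * ln (1 - t))"

lemma growth_exponent_alt: "2 * \<gamma> - 1 = 4 / sqrt 3"
  by (simp add: growth_exponent_def field_simps)

lemma growth_exponent_ge: "\<gamma> \<ge> 3 / 2"
proof -
  have "sqrt 3 \<le> 2" by (rule real_le_lsqrt) auto
  then have "4 / sqrt 3 \<ge> 2" by (simp add: field_simps)
  then show ?thesis using growth_exponent_alt by simp
qed

lemma growth_zero: "growth 0 = 0"
  by (simp add: growth_def)

lemma growth_has_real_derivative:
  assumes "\<bar>t\<bar> < 1"
  shows "(growth has_real_derivative growth_deriv t) (at t)"
proof -
  have *: "1 + t > 0" "1 - t > 0" and \<gamma>: "\<gamma> > 0" using assms growth_exponent_ge by auto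
  have "((\<lambda>t. (exp (\<gamma> * (ln (1 + t) - ln (1 - t))) - 1) / (2 * \<gamma>)) has_real_derivative
      exp (\<gamma> * (ln (1 + t) - ln (1 - t))) * (\<gamma> * (1 / (1 + t) + 1 / (1 - t))) / (2 * \<gamma>)) (at t)"
    using * \<gamma> by (auto intro!: derivative_eq_intros)
  also have "exp (\<gamma> * (ln (1 + t) - ln (1 - t))) * (\<gamma> * (1 / (1 + t) + 1 / (1 - t))) / (2 * \<gamma>)
      = exp (\<gamma> * (ln (1 + t) - ln (1 - t))) / ((1 + t) * (1 - t))"
  proof -
    have "\<gamma> * (1 / (1 + t) + 1 / (1 - t)) = 2 * \<gamma> / ((1 + t) * (1 - t))"
      using * by (simp add: divide_simps)
    then show ?thesis using \<gamma> by simp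
  qed
  also have "\<dots> = growth_deriv t"
    using * by (simp add: growth_deriv_def exp_diff exp_add exp_minus algebra_simps divide_simps)
  finally have "((\<lambda>t. (exp (\<gamma> * (ln (1 + t) - ln (1 - t))) - 1) / (2 * \<gamma>))
      has_real_derivative growth_deriv t) (at t)" .
  then show ?thesis
  proof (rule has_field_derivative_transform_within_open[of _ _ _ "{-1<..<1}"])
    fix s :: real assume "s \<in> {-1<..<1}"
    then show "(exp (\<gamma> * (ln (1 + s) - ln (1 - s))) - 1) / (2 * \<gamma>) = growth s"
      by (auto simp: growth_def powr_def ln_div)
  qed (use assms in auto)
qed

lemma continuous_on_growth: "continuous_on {-1<..<1} growth"
  by (intro continuous_at_imp_continuous_on ballI DERIV_isCont[OF growth_has_real_derivative]) auto

section \<open>Distortion\<close>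

context uniformly_convex_map
begin

text \<open>The Schwarz lemma for the dilatation \<open>g'/h'\<close>.\<close>
lemma deriv_g_bound:
  assumes z: "z \<in> ball 0 1"
  shows "cmod (deriv g z) \<le> cmod z * cmod (deriv h z)"
    and "cmod (deriv g z) < cmod (deriv h z)"
proof -
  have less: "cmod (deriv g z) < cmod (deriv h z)" if "z \<in> ball 0 1" for z
    using harmonic_jacobian_pos[OF that] by (simp add: harmonic_jacobian_def power2_less_imp_less)
  then have nz: "deriv h z \<noteq> 0" if "z \<in> ball 0 1" for z
    using that by force
  have "cmod (deriv g z / deriv h z) \<le> cmod z"
  proof (rule Schwarz_Lemma(1))
    show "(\<lambda>z. deriv g z / deriv h z) holomorphic_on ball 0 1"
      using nz by (intro holomorphic_on_divide holo')
  qed (use less nz deriv_g_zero z in \<open>auto simp: norm_divide divide_simps\<close>)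
  then show "cmod (deriv g z) \<le> cmod z * cmod (deriv h z)"
    using nz[OF z] by (simp add: norm_divide divide_simps)
  show "cmod (deriv g z) < cmod (deriv h z)" by (rule less[OF z])
qed

lemma harmonic_jacobian_zero: "harmonic_jacobian h g 0 = 1"
  using rep deriv_g_zero by (simp add: harmonic_jacobian_def harmonic_rep_def)

text \<open>\<open>D\<close> is the derivative of the Jacobian along the radius in direction \<open>e\<close>. For the first bound
  the centres are \<open>z - e * cis (\<plusminus>pi/6)\<close>, at distance \<open>1\<close> from \<open>z = t * e\<close>; they lie in the disc
  because \<open>\<bar>t - cis (\<plusminus>pi/6)\<bar>\<^sup>2 = 1 + t\<^sup>2 - \<surd>3 * t < 1\<close>. For the second one they lie on the
  other side of \<open>z\<close>, where only the distances \<open>\<rho> < 1 - t\<close> are safe, and \<open>\<rho>\<close> tends to \<open>1 - t\<close>.\<close>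
lemma radial_derivative_bounds:
  assumes e: "cmod e = 1" and t: "0 < t" "t < 1"
  defines "D \<equiv> 2 * Re (e * harmonic_jacobian_dz h g (of_real t * e))"
  shows "- (2 * \<gamma> - 1) * harmonic_jacobian h g (of_real t * e) \<le> D"
    and "(1 - t) * D \<le> (2 * \<gamma> - 1) * harmonic_jacobian h g (of_real t * e)"
proof -
  define z where "z = of_real t * e"
  define J where "J = harmonic_jacobian h g z"
  have z: "z \<in> ball 0 1" using e t by (simp add: z_def norm_mult)
  have J: "J > 0" using harmonic_jacobian_pos[OF z] by (simp add: J_def)
  have D_X: "D = 2 * Re (e * harmonic_jacobian_dz h g z)" by (simp only: D_def z_def)
  have bnd: "0 \<le> J + \<rho> * (sqrt 3 / 2) * Re (v * harmonic_jacobian_dz h g z)"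
    if "cmod v = 1" "0 < \<rho>" "z - of_real \<rho> * v * cis (pi / 6) \<in> ball 0 1"
      "z - of_real \<rho> * v * cis (- (pi / 6)) \<in> ball 0 1" for v \<rho>
    using harmonic_jacobian_dz_bound[OF z that] by (simp add: J_def)
  have less: "t * t < t * sqrt 3"
    using t by (intro mult_strict_left_mono order_less_le_trans[OF t(2)]) auto
  have "cmod (of_real t - cis s) < 1" if "cos s = sqrt 3 / 2" for s
  proof -
    have "(cmod (of_real t - cis s))\<^sup>2 = t\<^sup>2 - 2 * t * cos s + ((sin s)\<^sup>2 + (cos s)\<^sup>2)"
      unfolding cmod_power2 by (simp add: power2_eq_square algebra_simps)
    also have "\<dots> = t\<^sup>2 - 2 * t * cos s + 1" by simp
    finally have "(cmod (of_real t - cis s))\<^sup>2 = t * t - sqrt 3 * t + 1"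
      by (simp add: that power2_eq_square)
    then have "(cmod (of_real t - cis s))\<^sup>2 < 1\<^sup>2"
      using less by (simp add: mult.commute)
    then show ?thesis by (rule power2_less_imp_less) simp
  qed
  then have "cmod (e * (of_real t - cis s)) < 1" if "cos s = sqrt 3 / 2" for s
    using that e by (simp add: norm_mult)
  then have "z - of_real 1 * e * cis s \<in> ball 0 1" if "cos s = sqrt 3 / 2" for s
    using that by (simp add: z_def algebra_simps)
  then have "0 \<le> J + 1 * (sqrt 3 / 2) * Re (e * harmonic_jacobian_dz h g z)"
    using e by (intro bnd) (auto simp: cos_30)
  then have "0 \<le> J + (sqrt 3 / 4) * D" by (simp add: D_X del: times_complex.sel)
  then show "- (2 * \<gamma> - 1) * harmonic_jacobian h g (of_real t * e) \<le> D"
    unfolding growth_exponent_alt J_def z_def by (simp add: field_simps)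
  have D_\<rho>: "\<rho> * D \<le> (2 * \<gamma> - 1) * J" if \<rho>: "0 < \<rho>" "\<rho> < 1 - t" for \<rho>
  proof -
    have "z - of_real \<rho> * (- e) * cis s \<in> ball 0 1" for s
    proof -
      have "cmod (z - of_real \<rho> * (- e) * cis s) \<le> cmod z + cmod (of_real \<rho> * e * cis s)"
        by (simp add: norm_triangle_ineq)
      then show ?thesis using e t \<rho> by (simp add: z_def norm_mult)
    qed
    then have "0 \<le> J + \<rho> * (sqrt 3 / 2) * Re (- e * harmonic_jacobian_dz h g z)"
      using e \<rho> by (intro bnd) auto
    then have "\<rho> * (sqrt 3 / 4) * D \<le> J" by (simp add: D_X del: times_complex.sel)
    then show ?thesis unfolding growth_exponent_alt by (simp add: field_simps)
  qed
  show "(1 - t) * D \<le> (2 * \<gamma> - 1) * harmonic_jacobian h g (of_real t * e)"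
  proof (cases "D \<le> 0")
    case True
    then have "(1 - t) * D \<le> 0" using t by (simp add: mult_nonneg_nonpos)
    also have "0 \<le> (2 * \<gamma> - 1) * J" using J growth_exponent_ge by simp
    finally show ?thesis by (simp add: J_def z_def)
  next
    case False
    have "1 - t \<le> (2 * \<gamma> - 1) * J / D"
      by (rule dense_le_bounded[of 0]) (use D_\<rho> False t in \<open>simp_all add: pos_le_divide_eq\<close>)
    then show ?thesis using False by (simp add: field_simps J_def z_def)
  qed
qed

lemma has_vector_derivative_radius:
  "((\<lambda>t. of_real t * e) has_vector_derivative e) (at t)" for e :: complex
  unfolding has_vector_derivative_def
  by (auto intro!: derivative_eq_intros simp: scaleR_conv_of_real)

text \<open>Integrated radial bounds. The first conclusion is weaker than \<open>-(2\<gamma> - 1) * r\<close>, which the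
  radial derivative would give, but has the form of \<open>growth_deriv\<close>; the passage from one to the
  other rests on \<open>t\<^sup>2 - \<surd>3 * t + 1 > 0\<close>.\<close>
lemma harmonic_jacobian_bounds:
  assumes z: "z \<in> ball 0 1"
  defines "r \<equiv> cmod z"
  shows "(2 * \<gamma> - 3) * ln (1 - r) - (2 * \<gamma> + 1) * ln (1 + r) \<le> ln (harmonic_jacobian h g z)"
    and "ln (harmonic_jacobian h g z) \<le> - (2 * \<gamma> - 1) * ln (1 - r)"
proof -
  define e where "e = cis (Arg z)"
  define j where "j t = harmonic_jacobian h g (of_real t * e)" for t
  define j' where "j' t = 2 * Re (e * harmonic_jacobian_dz h g (of_real t * e))" for t
  have e: "cmod e = 1" by (simp add: e_def)
  have zr: "z = of_real r * e" using rcis_cmod_Arg[of z] by (simp add: r_def e_def rcis_def)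
  have r: "0 \<le> r" "r < 1" using z by (auto simp: r_def)
  have D: "of_real t * e \<in> ball 0 1" if "0 \<le> t" "t < 1" for t
    using that e by (simp add: norm_mult)
  have j_pos: "j t > 0" if "0 \<le> t" "t < 1" for t
    using D[OF that] harmonic_jacobian_pos by (simp add: j_def)
  have j': "(j has_real_derivative j' t) (at t)" if "0 \<le> t" "t < 1" for t
    unfolding j_def j'_def using has_vector_derivative_radius D[OF that] by (rule has_real_derivative_harmonic_jacobian)
  have cont: "continuous_on {0..r} (\<lambda>t. ln (j t))"
    using r j_pos j' by (intro continuous_at_imp_continuous_on ballI isCont_ln' DERIV_isCont[OF j'])
      (auto simp: less_imp_neq[symmetric])
  have j0: "j 0 = 1" by (simp add: j_def harmonic_jacobian_zero)
  have jr: "j r = harmonic_jacobian h g z" by (simp add: j_def zr)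
  have "ln (j 0) - (2 * \<gamma> - 3) * ln (1 - 0) + (2 * \<gamma> + 1) * ln (1 + 0)
      \<le> ln (j r) - (2 * \<gamma> - 3) * ln (1 - r) + (2 * \<gamma> + 1) * ln (1 + r)"
  proof (rule DERIV_nonneg_imp_increasing_open[where f = "\<lambda>t. ln (j t) - (2 * \<gamma> - 3) * ln (1 - t) + (2 * \<gamma> + 1) * ln (1 + t)"])
    fix t assume t: "0 < t" "t < r"
    then have t1: "t < 1" using r by simp
    have der: "((\<lambda>t. ln (j t) - (2 * \<gamma> - 3) * ln (1 - t) + (2 * \<gamma> + 1) * ln (1 + t))
      has_real_derivative j' t / j t + (2 * \<gamma> - 3) / (1 - t) + (2 * \<gamma> + 1) / (1 + t)) (at t)"
      using t t1 j_pos[of t] by (auto intro!: derivative_eq_intros j')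
    have sq: "0 \<le> (2 * \<gamma> - 1) * (1 + t\<^sup>2) - 4 * t"
    proof -
      have "0 \<le> (t - sqrt 3 / 2)\<^sup>2 + 1 / 4" by simp
      also have "\<dots> = 1 + t\<^sup>2 - sqrt 3 * t" by (simp add: power2_eq_square algebra_simps)
      finally have "0 \<le> (4 / sqrt 3) * (1 + t\<^sup>2 - sqrt 3 * t)" by simp
      then show ?thesis unfolding growth_exponent_alt by (simp add: algebra_simps)
    qed
    have "- (2 * \<gamma> - 1) \<le> j' t / j t"
      using radial_derivative_bounds(1)[OF e t(1) t1] j_pos[of t] t t1
      by (simp add: j_def j'_def pos_le_divide_eq)
    moreover have "(2 * \<gamma> - 3) / (1 - t) + (2 * \<gamma> + 1) / (1 + t) - (2 * \<gamma> - 1)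
        = ((2 * \<gamma> - 1) * (1 + t\<^sup>2) - 4 * t) / ((1 - t) * (1 + t))"
      using t t1 by (simp add: divide_simps) (simp add: power2_eq_square algebra_simps)
    moreover have "\<dots> \<ge> 0" using sq t t1 by simp
    ultimately have "0 \<le> j' t / j t + (2 * \<gamma> - 3) / (1 - t) + (2 * \<gamma> + 1) / (1 + t)" by linarith
    with der show "\<exists>y. ((\<lambda>t. ln (j t) - (2 * \<gamma> - 3) * ln (1 - t) + (2 * \<gamma> + 1) * ln (1 + t))
      has_real_derivative y) (at t) \<and> 0 \<le> y" by blast
  next
    show "continuous_on {0..r} (\<lambda>t. ln (j t) - (2 * \<gamma> - 3) * ln (1 - t) + (2 * \<gamma> + 1) * ln (1 + t))"
      using r by (intro continuous_intros cont) auto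
  qed (use r in simp)
  then show "(2 * \<gamma> - 3) * ln (1 - r) - (2 * \<gamma> + 1) * ln (1 + r) \<le> ln (harmonic_jacobian h g z)"
    by (simp add: j0 jr)
  have "ln (j r) + (2 * \<gamma> - 1) * ln (1 - r) \<le> ln (j 0) + (2 * \<gamma> - 1) * ln (1 - 0)"
  proof (rule DERIV_nonpos_imp_decreasing_open[where f = "\<lambda>t. ln (j t) + (2 * \<gamma> - 1) * ln (1 - t)"])
    fix t assume t: "0 < t" "t < r"
    then have t1: "t < 1" using r by simp
    have "((\<lambda>t. ln (j t) + (2 * \<gamma> - 1) * ln (1 - t))
      has_real_derivative j' t / j t - (2 * \<gamma> - 1) / (1 - t)) (at t)"
      using t t1 j_pos[of t] by (auto intro!: derivative_eq_intros j')
    moreover have "j' t / j t \<le> (2 * \<gamma> - 1) / (1 - t)"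
      using radial_derivative_bounds(2)[OF e t(1) t1] j_pos[of t] t t1
      by (simp add: j_def j'_def field_simps)
    ultimately show "\<exists>y. ((\<lambda>t. ln (j t) + (2 * \<gamma> - 1) * ln (1 - t)) has_real_derivative y) (at t) \<and> y \<le> 0"
      by (intro exI[of _ "j' t / j t - (2 * \<gamma> - 1) / (1 - t)"]) simp
  next
    show "continuous_on {0..r} (\<lambda>t. ln (j t) + (2 * \<gamma> - 1) * ln (1 - t))"
      using r by (intro continuous_intros cont) auto
  qed (use r in simp)
  then show "ln (harmonic_jacobian h g z) \<le> - (2 * \<gamma> - 1) * ln (1 - r)"
    by (simp add: j0 jr algebra_simps)
qed

text \<open>The product of the largest stretching \<open>S\<close> and the smallest stretching \<open>d\<close> is the Jacobian, and
  the Schwarz lemma bounds their quotient: \<open>S/d \<le> (1 + r)/(1 - r)\<close>. So \<open>S\<^sup>2 \<le> J * (1 + r)/(1 - r)\<close> and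
  \<open>d\<^sup>2 \<ge> J * (1 - r)/(1 + r)\<close>, and the bounds of \<open>J\<close> apply.\<close>
lemma stretching_bounds:
  assumes z: "z \<in> ball 0 1"
  shows "cmod (deriv h z) + cmod (deriv g z) \<le> growth_deriv (cmod z)"
    and "growth_deriv (- cmod z) \<le> cmod (deriv h z) - cmod (deriv g z)"
proof -
  define r where "r = cmod z"
  define S where "S = cmod (deriv h z) + cmod (deriv g z)"
  define d where "d = cmod (deriv h z) - cmod (deriv g z)"
  have r: "0 \<le> r" "r < 1" using z by (auto simp: r_def)
  have d: "0 < d" using deriv_g_bound(2)[OF z] by (simp add: d_def)
  then have S: "0 < S" using norm_ge_zero[of "deriv g z"] unfolding S_def d_def by linarith
  have J: "harmonic_jacobian h g z = S * d"
    by (simp add: harmonic_jacobian_def S_def d_def power2_eq_square algebra_simps)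
  have lnJ: "ln (harmonic_jacobian h g z) = ln S + ln d" using S d by (simp add: J ln_mult)
  have "S * (1 - r) \<le> d * (1 + r)"
    using deriv_g_bound(1)[OF z] by (simp add: S_def d_def r_def algebra_simps)
  then have "ln (S * (1 - r)) \<le> ln (d * (1 + r))" using S d r by (subst ln_le_cancel_iff) auto
  then have ratio: "ln S + ln (1 - r) \<le> ln d + ln (1 + r)" using S d r by (simp add: ln_mult)
  have ln_signs: "0 \<le> ln (1 + r)" "ln (1 - r) \<le> 0" using r by auto
  have "0 \<le> (2 * \<gamma> - 3) * ln (1 + r)" using ln_signs growth_exponent_ge by simp
  then have "2 * ln S \<le> 2 * ((\<gamma> - 1) * ln (1 + r) - (\<gamma> + 1) * ln (1 - r))"
    using harmonic_jacobian_bounds(2)[OF z] ratio ln_signs unfolding lnJ r_def[symmetric]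
    by (simp add: algebra_simps)
  then have "exp (ln S) \<le> growth_deriv r" by (simp add: growth_deriv_def)
  then show "cmod (deriv h z) + cmod (deriv g z) \<le> growth_deriv (cmod z)"
    using S by (simp add: S_def r_def)
  have "2 * ((\<gamma> - 1) * ln (1 - r) - (\<gamma> + 1) * ln (1 + r)) \<le> 2 * ln d"
    using harmonic_jacobian_bounds(1)[OF z] ratio unfolding lnJ r_def[symmetric]
    by (simp add: algebra_simps)
  then have "growth_deriv (- r) \<le> exp (ln d)" by (simp add: growth_deriv_def)
  then show "growth_deriv (- cmod z) \<le> cmod (deriv h z) - cmod (deriv g z)"
    using d by (simp add: d_def r_def)
qed

section \<open>Growth\<close>

lemma growth_upper:
  assumes z: "z \<in> ball 0 1" "z \<noteq> 0"
  shows "cmod (f z) \<le> growth (cmod z)"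
proof -
  define r where "r = cmod z"
  define e where "e = cis (Arg z)"
  have e: "cmod e = 1" by (simp add: e_def)
  have zr: "z = of_real r * e" using rcis_cmod_Arg[of z] by (simp add: r_def e_def rcis_def)
  have r: "0 < r" "r < 1" using z by (auto simp: r_def)
  have D: "of_real t * e \<in> ball 0 1" if "0 \<le> t" "t \<le> r" for t
    using that r e by (simp add: norm_mult)
  define p' where "p' t = deriv h (of_real t * e) * e + cnj (deriv g (of_real t * e) * e)" for t
  have p': "((\<lambda>t. f (of_real t * e)) has_vector_derivative p' t) (at t)" if "0 \<le> t" "t \<le> r" for t
    unfolding p'_def using has_vector_derivative_radius D[OF that] by (rule has_vector_derivative_f)
  have "norm (f (of_real r * e) - f (of_real 0 * e)) \<le> growth r - growth 0"
  proof (rule differentiable_bound_general[OF r(1)])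
    show "continuous_on {0..r} (\<lambda>t. f (of_real t * e))"
      by (intro continuous_at_imp_continuous_on ballI has_vector_derivative_continuous[OF p']) auto
    show "continuous_on {0..r} growth"
      using r by (intro continuous_on_subset[OF continuous_on_growth]) auto
  next
    fix t assume t: "0 < t" "t < r"
    show "((\<lambda>t. f (of_real t * e)) has_vector_derivative p' t) (at t)" using t by (intro p') auto
    show "(growth has_vector_derivative growth_deriv t) (at t)"
      using t r growth_has_real_derivative[of t]
      by (simp add: has_real_derivative_iff_has_vector_derivative)
    have "cmod (p' t) \<le> cmod (deriv h (of_real t * e)) + cmod (deriv g (of_real t * e))"
      unfolding p'_def by (rule norm_triangle_le) (simp add: norm_mult e)
    also have "\<dots> \<le> growth_deriv (cmod (of_real t * e))"
      using t by (intro stretching_bounds(1) D) auto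
    finally show "cmod (p' t) \<le> growth_deriv t" using t e by (simp add: norm_mult)
  qed
  then show ?thesis unfolding zr[symmetric] by (simp add: f_zero growth_zero r_def)
qed

text \<open>The real linear map \<open>v \<mapsto> A * v + cnj (B * v)\<close> has the inverse
  \<open>w \<mapsto> (cnj A * w - cnj B * cnj w) / (\<bar>A\<bar>\<^sup>2 - \<bar>B\<bar>\<^sup>2)\<close>.\<close>
lemma inverse_has_derivative:
  assumes z: "z \<in> ball 0 1"
  obtains L where "(inv_into (ball 0 1) f has_derivative L) (at (f z))"
    "\<And>w. deriv h z * L w + cnj (deriv g z * L w) = w"
proof
  define A where "A = deriv h z"
  define B where "B = deriv g z"
  define L where "L w = (cnj A * w - cnj B * cnj w) / of_real (harmonic_jacobian h g z)" for w
  have J: "of_real (harmonic_jacobian h g z) = A * cnj A - B * cnj B"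
    by (simp add: harmonic_jacobian_def A_def B_def complex_norm_square[symmetric] del: of_real_power)
  have J0: "complex_of_real (harmonic_jacobian h g z) \<noteq> 0" using harmonic_jacobian_pos[OF z] by simp
  show L: "deriv h z * L w + cnj (deriv g z * L w) = w" for w
  proof -
    have "A * L w + cnj (B * L w) = (A * cnj A - B * cnj B) * w / of_real (harmonic_jacobian h g z)"
      using J0 by (simp add: L_def field_simps)
    also have "\<dots> = w" using J0 unfolding J by simp
    finally show ?thesis by (simp add: A_def B_def)
  qed
  show "(inv_into (ball 0 1) f has_derivative L) (at (f z))"
    by (rule has_derivative_inverse_strong[OF open_ball z continuous_on_f _ has_derivative_f[OF z]])
      (use inj_f L in \<open>auto simp: fun_eq_iff\<close>)
qed

text \<open>Let \<open>q\<close> be the preimage under \<open>f\<close> of the segment \<open>t \<mapsto> t * f z\<close>. Its image has speed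
  \<open>\<bar>f z\<bar>\<close>, which is at least the smallest stretching times \<open>\<bar>q'\<bar>\<close>. Therefore the derivative of
  \<open>t \<mapsto> - growth (- \<bar>q t\<bar>)\<close> is at most \<open>\<bar>f z\<bar>\<close>, and over \<open>[0, 1]\<close> this function grows from \<open>0\<close>
  to \<open>- growth (- \<bar>z\<bar>)\<close>.\<close>
lemma growth_lower:
  assumes z: "z \<in> ball 0 1" "z \<noteq> 0"
  shows "- growth (- cmod z) \<le> cmod (f z)"
proof -
  define w where "w = f z"
  define G where "G = inv_into (ball 0 1) f"
  define q where "q t = G (of_real t * w)" for t :: real
  define R where "R = (1 + cmod z) / 2"
  have R: "0 < R" "R < 1" "cmod z < R" using z norm_ge_zero[of z] by (auto simp: R_def intro: add_pos_nonneg)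
  have "convex (f ` ball 0 R)"
    using uc R by (auto simp: uniformly_convex_def fully_convex_def)
  moreover have "0 \<in> f ` ball 0 R" "w \<in> f ` ball 0 R"
    using R image_eqI[of 0 f 0] f_zero by (simp_all add: w_def)
  ultimately have seg: "of_real t * w \<in> f ` ball 0 R" if "0 \<le> t" "t \<le> 1" for t
    using convexD[of _ 0 w "1 - t" t] that by (simp add: scaleR_conv_of_real)
  have q: "q t \<in> ball 0 1" "f (q t) = of_real t * w" if t: "0 \<le> t" "t \<le> 1" for t
  proof -
    obtain x where x: "x \<in> ball 0 1" "f x = of_real t * w" using seg[OF t] subset_ball[of R 1 0] R by fastforce
    then have "q t = x" unfolding q_def G_def x(2)[symmetric] by (intro inv_into_f_f inj_f)
    then show "q t \<in> ball 0 1" "f (q t) = of_real t * w" using x by simp_all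
  qed
  have q': "\<exists>d. (q has_vector_derivative d) (at t) \<and>
      deriv h (q t) * d + cnj (deriv g (q t) * d) = w" if t: "0 \<le> t" "t \<le> 1" for t
  proof -
    obtain L where L: "(G has_derivative L) (at (of_real t * w))"
      "\<And>w. deriv h (q t) * L w + cnj (deriv g (q t) * L w) = w"
      using inverse_has_derivative[OF q(1)[OF t]] q(2)[OF t] unfolding G_def by metis
    have "(q has_derivative (\<lambda>s. L (s *\<^sub>R w))) (at t)"
      using has_derivative_compose[OF has_vector_derivative_radius[unfolded has_vector_derivative_def] L(1)]
      by (simp add: q_def[abs_def])
    then have "(q has_vector_derivative L w) (at t)"
      unfolding has_vector_derivative_def
      by (simp add: linear_scale[OF has_derivative_linear[OF L(1)]])
    with L(2) show ?thesis by blast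
  qed
  have "1 * cmod w + growth (- cmod (q 1)) \<ge> 0 * cmod w + growth (- cmod (q 0))"
  proof (rule DERIV_nonneg_imp_increasing_open[where f = "\<lambda>t. t * cmod w + growth (- cmod (q t))"])
    fix t :: real assume t: "0 < t" "t < 1"
    obtain d where d: "(q has_vector_derivative d) (at t)"
      "deriv h (q t) * d + cnj (deriv g (q t) * d) = w" using q'[of t] t by auto
    have qt: "q t \<in> ball 0 1" "f (q t) = of_real t * w" using q[of t] t by auto
    \<comment> \<open>\<open>cmod\<close> is differentiable at \<open>q t\<close> only because the preimage avoids \<open>0\<close> for \<open>t > 0\<close>\<close>
    have "w \<noteq> 0"
      using inj_onD[OF inj_f, of z 0] z by (auto simp: w_def f_zero)
    then have "q t \<noteq> 0" using qt t f_zero by auto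
    have "((\<lambda>t. cmod (q t)) has_derivative (\<lambda>s. inner (s *\<^sub>R d) (sgn (q t)))) (at t)"
      using has_derivative_compose[OF d(1)[unfolded has_vector_derivative_def]
          has_derivative_norm[OF \<open>q t \<noteq> 0\<close>]] .
    then have norm': "((\<lambda>t. cmod (q t)) has_real_derivative inner d (sgn (q t))) (at t)"
      unfolding has_field_derivative_def
      by (rule has_derivative_eq_rhs) (auto simp: fun_eq_iff)
    have "((\<lambda>t. t * cmod w + growth (- cmod (q t))) has_real_derivative
        cmod w - growth_deriv (- cmod (q t)) * inner d (sgn (q t))) (at t)"
      using qt(1)
      by (auto intro!: derivative_eq_intros norm' DERIV_chain2[OF growth_has_real_derivative])
    moreover have "growth_deriv (- cmod (q t)) * inner d (sgn (q t)) \<le> cmod w"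
    proof -
      have "inner d (sgn (q t)) \<le> cmod d * cmod (sgn (q t))" by (rule norm_cauchy_schwarz)
      then have "inner d (sgn (q t)) \<le> cmod d" using \<open>q t \<noteq> 0\<close> by (simp add: norm_sgn)
      then have "growth_deriv (- cmod (q t)) * inner d (sgn (q t)) \<le> growth_deriv (- cmod (q t)) * cmod d"
        by (intro mult_left_mono) (auto simp: growth_deriv_def)
      also have "\<dots> \<le> (cmod (deriv h (q t)) - cmod (deriv g (q t))) * cmod d"
        using stretching_bounds(2)[OF qt(1)] by (intro mult_right_mono) auto
      also have "\<dots> = cmod (deriv h (q t) * d) - cmod (cnj (deriv g (q t) * d))"
        by (simp add: norm_mult algebra_simps)
      also have "\<dots> \<le> cmod w" unfolding d(2)[symmetric] by (rule norm_diff_ineq)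
      finally show ?thesis .
    qed
    ultimately show "\<exists>y. ((\<lambda>t. t * cmod w + growth (- cmod (q t))) has_real_derivative y) (at t) \<and> 0 \<le> y"
      by (intro exI[of _ "cmod w - growth_deriv (- cmod (q t)) * inner d (sgn (q t))"]) simp
  next
    have "continuous_on {0..1} q"
      using q' by (intro continuous_at_imp_continuous_on ballI)
        (metis atLeastAtMost_iff has_vector_derivative_continuous)
    moreover have minus_one_less_cmod: "- 1 < cmod x" for x
      by (rule less_le_trans[OF _ norm_ge_zero]) simp
    ultimately show "continuous_on {0..1} (\<lambda>t. t * cmod w + growth (- cmod (q t)))"
      using q(1)
      by (intro continuous_intros continuous_on_compose2[OF continuous_on_growth])
        (auto simp: minus_one_less_cmod)
  qed simp
  moreover have "q 0 = 0" "q 1 = z"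
    using inv_into_f_f[OF inj_f, of 0] inv_into_f_f[OF inj_f z(1)]
    by (simp_all add: q_def G_def w_def f_zero)
  ultimately show ?thesis by (simp add: growth_zero w_def)
qed

section \<open>The second coefficient\<close>

text \<open>At the origin \<open>J = 1\<close> and \<open>\<partial>J/\<partial>z = h''(0)\<close>. The direction \<open>v\<close> is chosen so that
  \<open>v * h''(0)\<close> is negative, and \<open>\<rho>\<close> tends to \<open>1\<close>.\<close>
lemma second_coefficient_bound: "cmod (deriv (deriv h) 0) \<le> 2 / sqrt 3"
proof (cases "deriv (deriv h) 0 = 0")
  case False
  define A where "A = deriv (deriv h) 0"
  define v where "v = - cnj (sgn A)"
  have v: "cmod v = 1" using False by (simp add: v_def A_def norm_sgn)
  have "v * harmonic_jacobian_dz h g 0 = - of_real (cmod A)"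
  proof -
    have "harmonic_jacobian_dz h g 0 = A"
      using rep deriv_g_zero by (simp add: harmonic_jacobian_dz_def A_def harmonic_rep_def)
    moreover have "cnj (sgn A) * A = of_real (cmod A)"
      using False complex_norm_square[of A]
      by (simp add: sgn_eq A_def field_simps power2_eq_square)
    ultimately show ?thesis by (simp add: v_def)
  qed
  then have *: "\<rho> * (sqrt 3 / 2 * cmod A) \<le> 1" if "0 < \<rho>" "\<rho> < 1" for \<rho>
    using harmonic_jacobian_dz_bound[of 0 v \<rho>] that v
    by (simp add: norm_mult harmonic_jacobian_zero)
  have pos: "0 < sqrt 3 / 2 * cmod A" using False by (simp add: A_def)
  have "1 \<le> 1 / (sqrt 3 / 2 * cmod A)"
    by (rule dense_le_bounded[of 0]) (use * in \<open>simp_all only: pos_le_divide_eq[OF pos] zero_less_one\<close>)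
  then show ?thesis using False by (simp add: field_simps A_def)
qed auto

end

lemma second_coefficient_eq_deriv:
  assumes "\<And>z. z \<in> ball 0 1 \<Longrightarrow> (\<lambda>n. a (n + 2) * z ^ (n + 2)) sums (h z - z)"
  shows "a 2 = deriv (deriv h) 0 / (2 :: complex)"
proof -
  define c where "c n = (if n = 0 then 0 else if n = 1 then 1 else a n)" for n :: nat
  have "(\<lambda>n. fps_nth (Abs_fps c) n * z ^ n) sums h z" if "z \<in> ball 0 1" for z
  proof -
    have "(\<lambda>n. c (n + 2) * z ^ (n + 2)) sums (h z - z)" using assms[OF that] by (simp add: c_def)
    then show ?thesis
      by (subst (asm) sums_iff_shift) (simp add: c_def eval_nat_numeral)
  qed
  then have "eventually (\<lambda>z. (\<lambda>n. fps_nth (Abs_fps c) n * z ^ n) sums h z) (nhds 0)"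
    unfolding eventually_nhds by (intro exI[of _ "ball 0 1"]) auto
  then have "h has_fps_expansion Abs_fps c" by (rule has_fps_expansionI)
  from fps_nth_fps_expansion[OF this, of 2] show ?thesis
    by (simp add: c_def eval_nat_numeral)
qed

section \<open>Coefficient bound and growth theorem\<close>

lemma class_UKH0_imp_uniformly_convex_map:
  assumes "f \<in> class_UKH0" "harmonic_rep f h g"
  shows "uniformly_convex_map f h g"
proof -
  interpret harmonic_map f h g by unfold_locales (rule assms)
  have "f \<in> class_SH0" and uc: "uniformly_convex f"
    using assms(1) by (auto simp: class_UKH0_def)
  then obtain h1 g1 h2 g2 where *: "harmonic_rep f h1 g1" "inj_on f (ball 0 1)"
    "\<And>z. z \<in> ball 0 1 \<Longrightarrow> (cmod (deriv h1 z))\<^sup>2 - (cmod (deriv g1 z))\<^sup>2 > 0"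
    "harmonic_rep f h2 g2" "deriv g2 0 = 0"
    unfolding class_SH0_def class_SH_def by blast
  show ?thesis
  proof
    show "0 < harmonic_jacobian h g z" if "z \<in> ball 0 1" for z
      using *(3)[OF that] derivs_unique[OF *(1) that] by (simp add: harmonic_jacobian_def)
    show "deriv g 0 = 0" using derivs_unique(2)[OF *(4), of 0] *(5) by simp
  qed (fact uc *(2))+
qed

theorem theorem4:
  shows "(\<forall>f h g. \<forall>a :: nat \<Rightarrow> complex.
            f \<in> class_UKH0 \<and> harmonic_rep f h g \<and>
            (\<forall>z\<in>unit_disc. (\<lambda>n. a (n + 2) * z ^ (n + 2)) sums (h z - z)) \<longrightarrow>
            cmod (a 2) \<le> 1 / sqrt 3) \<and>
         (\<forall>f \<in> class_UKH0. \<forall>z :: complex. \<forall>r :: real.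
            0 < r \<and> cmod z = r \<and> r < 1 \<longrightarrow>
            (sqrt 3 / (sqrt 3 + 4)) *
              (1 - ((1 - r) / (1 + r)) powr ((sqrt 3 + 4) / (2 * sqrt 3))) \<le> cmod (f z) \<and>
            cmod (f z) \<le> (sqrt 3 / (sqrt 3 + 4)) *
              (((1 + r) / (1 - r)) powr ((sqrt 3 + 4) / (2 * sqrt 3)) - 1))"
proof (intro conjI allI ballI impI; (elim conjE)?)
  fix f h g and a :: "nat \<Rightarrow> complex"
  assume "f \<in> class_UKH0" "harmonic_rep f h g"
    and a: "\<forall>z\<in>unit_disc. (\<lambda>n. a (n + 2) * z ^ (n + 2)) sums (h z - z)"
  then interpret uniformly_convex_map f h g by (intro class_UKH0_imp_uniformly_convex_map)
  have a2: "a 2 = deriv (deriv h) 0 / 2" using a by (intro second_coefficient_eq_deriv) blast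
  show "cmod (a 2) \<le> 1 / sqrt 3"
    unfolding a2 norm_divide using second_coefficient_bound by simp
next
  fix f and z :: complex and r :: real
  assume f: "f \<in> class_UKH0" and r: "0 < r" "cmod z = r" "r < 1"
  then obtain h g where "harmonic_rep f h g"
    by (auto simp: class_UKH0_def class_SH0_def)
  with f interpret uniformly_convex_map f h g by (rule class_UKH0_imp_uniformly_convex_map)
  have z: "z \<in> ball 0 1" "z \<noteq> 0" using r by auto
  have factor: "1 / (2 * \<gamma>) = sqrt 3 / (sqrt 3 + 4)"
  proof -
    have "2 * \<gamma> = (sqrt 3 + 4) / sqrt 3" by (simp add: growth_exponent_def del: distrib_left_numeral)
    then show ?thesis by simp
  qed
  have up: "growth r = (sqrt 3 / (sqrt 3 + 4)) * (((1 + r) / (1 - r)) powr \<gamma> - 1)"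
    unfolding factor[symmetric] by (simp add: growth_def)
  have low: "- growth (- r) = (sqrt 3 / (sqrt 3 + 4)) * (1 - ((1 - r) / (1 + r)) powr \<gamma>)"
    unfolding factor[symmetric] by (simp add: growth_def diff_divide_distrib)
  show "(sqrt 3 / (sqrt 3 + 4)) *
      (1 - ((1 - r) / (1 + r)) powr ((sqrt 3 + 4) / (2 * sqrt 3))) \<le> cmod (f z)"
    using growth_lower[OF z] unfolding r(2) low growth_exponent_def .
  show "cmod (f z) \<le> (sqrt 3 / (sqrt 3 + 4)) *
      (((1 + r) / (1 - r)) powr ((sqrt 3 + 4) / (2 * sqrt 3)) - 1)"
    using growth_upper[OF z] unfolding r(2) up growth_exponent_def .
qed

end
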